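(* Let $\mathcal K=(K,\Gamma,\mathbf k;v,\pi)$ be a $\sigma$-henselian valued difference field with $\operatorname{char}(\mathbf k)=0$, and let $K_0\subseteq\mathcal O$ be a difference subfield of $K$ (i.e. a subfield with $\sigma(K_0)=K_0$). Then there is a difference subfield $K_1$ of $K$ with $K_0\subseteq K_1\subseteq\mathcal O$ and $\pi(K_1)=\mathbf k$.
   Context: A valued difference field is $(K,\Gamma,\mathbf k;v,\pi)$ with $K$ a field with automorphism $\sigma$, $v:K^\times\to\Gamma$ a surjective valuation onto an ordered abelian group with valuation ring $\mathcal O$, $\pi:\mathcal O\to\mathbf k$ the residue map; $\sigma(\mathcal O)=\mathcal O$, and $v(\sigma(a))=v(a)$ for all $a\in K^\times$ (Axiom 1, standing). A $\sigma$-polynomial of order $\le n$ is $G(x)=g(x,\sigma(x),\dots,\sigma^n(x))$, $g\in K[x_0,\dots,x_n]$; with $g(\mathbf x+\mathbf y)=\sum_{\mathbf i}g_{(\mathbf i)}(\mathbf x)\mathbf y^{\mathbf i}$ put $G_{(\mathbf i)}(x)=g_{(\mathbf i)}(x,\dots,\sigma^n(x))$. $\mathcal K$ is $\sigma$-henselian if whenever $G$ has coefficients in $\mathcal O$, $a\in\mathcal O$, $v(G(a))>0$ and $\min_{|\mathbf i|=1}v(G_{(\mathbf i)}(a))=0$, there is $b\in\mathcal O$ with $G(b)=0$ and $v(a-b)\ge v(G(a))$. *)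

theory Defs
  imports Complex_Main "HOL-Library.Poly_Mapping" "HOL-Library.Extended"
    "HOL-Computational_Algebra.Computational_Algebra"
begin

text \<open>
  Polynomials in the variables $x_0, x_1, \dots$ are finitely supported functions from multi-indices
  (themselves finitely supported functions from variables to exponents) to coefficients; the ring
  structure on them is the convolution structure of \<^theory>\<open>HOL-Library.Poly_Mapping\<close>.
\<close>

type_synonym multiindex = "nat \<Rightarrow>\<^sub>0 nat"
type_synonym 'a mvpoly = "multiindex \<Rightarrow>\<^sub>0 'a"

text \<open>$K[x_0,\dots,x_n]$\<close>
definition mvpolys :: "nat \<Rightarrow> ('a::zero) mvpoly set" where
  "mvpolys n = {g. \<forall>m \<in> Poly_Mapping.keys g. Poly_Mapping.keys m \<subseteq> {..n}}"

definition mv_const :: "'a::zero \<Rightarrow> 'a mvpoly" where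
  "mv_const c = Poly_Mapping.single 0 c"

definition mv_var :: "nat \<Rightarrow> ('a::zero_neq_one) mvpoly" where
  "mv_var j = Poly_Mapping.single (Poly_Mapping.single j 1) 1"

text \<open>Substitution of \<open>p j\<close> for $x_j$, with the coefficients mapped along \<open>h\<close>.\<close>
definition mv_subst :: "('a::zero \<Rightarrow> 'b::comm_semiring_1) \<Rightarrow> (nat \<Rightarrow> 'b) \<Rightarrow> 'a mvpoly \<Rightarrow> 'b" where
  "mv_subst h p g =
     (\<Sum>m \<in> Poly_Mapping.keys g.
        h (Poly_Mapping.lookup g m) *
        (\<Prod>j \<in> Poly_Mapping.keys m. p j ^ Poly_Mapping.lookup m j))"

text \<open>
  $g(\mathbf x + \mathbf y)$ as an element of $K[\mathbf x][\mathbf y]$: the outer polynomial variables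
  are the $y_j$, and the $x_j$ live in the coefficient ring. The coefficient of $\mathbf y^{\mathbf i}$
  is $g_{(\mathbf i)}(\mathbf x)$.
\<close>
definition mv_shift :: "('a::comm_ring_1) mvpoly \<Rightarrow> 'a mvpoly mvpoly" where
  "mv_shift g = mv_subst (\<lambda>c. mv_const (mv_const c)) (\<lambda>j. mv_const (mv_var j) + mv_var j) g"

definition mv_taylor :: "multiindex \<Rightarrow> ('a::comm_ring_1) mvpoly \<Rightarrow> 'a mvpoly" where
  "mv_taylor i g = Poly_Mapping.lookup (mv_shift g) i"

text \<open>$|\mathbf i| = i_0 + \dots + i_n$\<close>
definition mi_deg :: "multiindex \<Rightarrow> nat" where
  "mi_deg i = (\<Sum>j \<in> Poly_Mapping.keys i. Poly_Mapping.lookup i j)"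

text \<open>So the minimum over $|\mathbf i| = 1$ below ranges over a nonempty finite set.\<close>
lemma multiindices_deg_1:
  "{i. Poly_Mapping.keys i \<subseteq> {..n} \<and> mi_deg i = 1} = (\<lambda>j. Poly_Mapping.single j 1) ` {..n}"
proof (intro equalityI subsetI)
  fix i assume "i \<in> {i. Poly_Mapping.keys i \<subseteq> {..n} \<and> mi_deg i = 1}"
  then have sub: "Poly_Mapping.keys i \<subseteq> {..n}"
    and d: "(\<Sum>j \<in> Poly_Mapping.keys i. Poly_Mapping.lookup i j) = Suc 0"
    by (auto simp: mi_deg_def)
  from d obtain j where j: "j \<in> Poly_Mapping.keys i" "Poly_Mapping.lookup i j = Suc 0"
    and o: "\<forall>k \<in> Poly_Mapping.keys i. j \<noteq> k \<longrightarrow> Poly_Mapping.lookup i k = 0"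
    by (subst (asm) sum_eq_Suc0_iff) auto
  have "i = Poly_Mapping.single j 1"
    using j o by (intro poly_mapping_eqI) (auto simp: lookup_single when_def in_keys_iff)
  with j sub show "i \<in> (\<lambda>j. Poly_Mapping.single j 1) ` {..n}" by blast
qed (auto simp: mi_deg_def)

text \<open>$G(a) = g(a, \sigma(a), \dots, \sigma^n(a))$\<close>
definition sigma_eval :: "('a \<Rightarrow> 'a) \<Rightarrow> ('a::comm_semiring_1) mvpoly \<Rightarrow> 'a \<Rightarrow> 'a" where
  "sigma_eval \<sigma> g a = mv_subst (\<lambda>c. c) (\<lambda>j. (\<sigma> ^^ j) a) g"

text \<open>The usual extension of \<open>v\<close> by $v(0) = \infty$; the value \<open>v 0\<close> itself is never used.\<close>
definition val :: "('a::zero \<Rightarrow> 'g) \<Rightarrow> 'a \<Rightarrow> 'g extended" where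
  "val v a = (if a = 0 then Pinf else Fin (v a))"

definition val_ring :: "('a::zero \<Rightarrow> 'g::linordered_ab_group_add) \<Rightarrow> 'a set" where
  "val_ring v = {a. 0 \<le> val v a}"

text \<open>\<open>\<pi>\<close> is total in HOL, but is constrained only on the valuation ring.\<close>
locale valued_difference_field =
  fixes \<sigma> :: "'a::field \<Rightarrow> 'a"
    and v :: "'a \<Rightarrow> 'g::linordered_ab_group_add"
    and \<pi> :: "'a \<Rightarrow> 'k::field"
  assumes sigma_bij: "bij \<sigma>"
    and sigma_one: "\<sigma> 1 = 1"
    and sigma_add: "\<sigma> (a + b) = \<sigma> a + \<sigma> b"
    and sigma_mult: "\<sigma> (a * b) = \<sigma> a * \<sigma> b"
    and v_surj: "v ` (UNIV - {0}) = UNIV"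
    and v_mult: "a \<noteq> 0 \<Longrightarrow> b \<noteq> 0 \<Longrightarrow> v (a * b) = v a + v b"
    and v_add: "a \<noteq> 0 \<Longrightarrow> b \<noteq> 0 \<Longrightarrow> a + b \<noteq> 0 \<Longrightarrow> min (v a) (v b) \<le> v (a + b)"
    and res_surj: "\<pi> ` val_ring v = UNIV"
    and res_one: "\<pi> 1 = 1"
    and res_add: "a \<in> val_ring v \<Longrightarrow> b \<in> val_ring v \<Longrightarrow> \<pi> (a + b) = \<pi> a + \<pi> b"
    and res_mult: "a \<in> val_ring v \<Longrightarrow> b \<in> val_ring v \<Longrightarrow> \<pi> (a * b) = \<pi> a * \<pi> b"
    and res_eq_0_iff: "a \<in> val_ring v \<Longrightarrow> \<pi> a = 0 \<longleftrightarrow> 0 < val v a"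
    and sigma_val_ring: "\<sigma> ` val_ring v = val_ring v"
    and v_sigma: "a \<noteq> 0 \<Longrightarrow> v (\<sigma> a) = v a"

definition sigma_henselian ::
    "('a::field \<Rightarrow> 'a) \<Rightarrow> ('a \<Rightarrow> 'g::linordered_ab_group_add) \<Rightarrow> bool" where
  "sigma_henselian \<sigma> v \<longleftrightarrow>
     (\<forall>n. \<forall>g \<in> mvpolys n. \<forall>a \<in> val_ring v.
        (\<forall>m. Poly_Mapping.lookup g m \<in> val_ring v) \<longrightarrow>
        0 < val v (sigma_eval \<sigma> g a) \<longrightarrow>
        Min ((\<lambda>i. val v (sigma_eval \<sigma> (mv_taylor i g) a)) `
          {i. Poly_Mapping.keys i \<subseteq> {..n} \<and> mi_deg i = 1}) = 0 \<longrightarrow>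
        (\<exists>b \<in> val_ring v. sigma_eval \<sigma> g b = 0 \<and>
           val v (sigma_eval \<sigma> g a) \<le> val v (a - b)))"

definition difference_subfield :: "('a::field \<Rightarrow> 'a) \<Rightarrow> 'a set \<Rightarrow> bool" where
  "difference_subfield \<sigma> F \<longleftrightarrow>
     0 \<in> F \<and> 1 \<in> F \<and>
     (\<forall>a \<in> F. \<forall>b \<in> F. a + b \<in> F \<and> a * b \<in> F) \<and>
     (\<forall>a \<in> F. - a \<in> F) \<and>
     (\<forall>a \<in> F. a \<noteq> 0 \<longrightarrow> inverse a \<in> F) \<and>
     \<sigma> ` F = F"

end

theory Submission
  imports Defs
begin

text \<open>
  By Zorn's lemma it suffices to show that a difference subfield $E \subseteq \mathcal O$ extends to
  one whose residues contain a given $\alpha \in \mathbf k$. Let $a$ be a lift of $\alpha$. If the conjugates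
  $\alpha, \bar\sigma(\alpha), \dots$ of $\alpha$ are algebraically independent over $\pi(E)$, then $\pi$ is injective
  on $E[a, \sigma(a), \dots]$, so its fraction field stays in $\mathcal O$.

  Otherwise let $n$ be least such that $\bar\sigma^n(\alpha)$ is algebraic over the residues of
  $E, a, \dots, \sigma^{n-1}(a)$, and take a relation $g$ over $E$ of least degree in $x_n$. As
  $\operatorname{char}(\mathbf k) = 0$, its derivative $\partial g/\partial x_n$ does not vanish at the
  residues, so $\sigma$-henselianity corrects $a$ to a lift $b$ with $G(b) = 0$. The field
  $E(b, \dots, \sigma^{n-1}(b))$ stays in $\mathcal O$ by independence, and the elements $\sigma^m(b)$ with
  $m \ge n$ are successively algebraic over it; an algebraic extension of a trivially valued
  field is trivially valued.
\<close>

subsection \<open>Subfields and adjunction\<close>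

definition is_subring :: "'a::comm_ring_1 set \<Rightarrow> bool" where
  "is_subring S \<longleftrightarrow> 0 \<in> S \<and> 1 \<in> S \<and> (\<forall>a\<in>S. \<forall>b\<in>S. a + b \<in> S \<and> a * b \<in> S) \<and> (\<forall>a\<in>S. - a \<in> S)"

definition is_subfield :: "'a::field set \<Rightarrow> bool" where
  "is_subfield F \<longleftrightarrow> is_subring F \<and> (\<forall>a\<in>F. a \<noteq> 0 \<longrightarrow> inverse a \<in> F)"

definition poly_over :: "'a::comm_ring_1 set \<Rightarrow> 'a poly set" where
  "poly_over S = {q. \<forall>i. coeff q i \<in> S}"

text \<open>This is \<open>S[x]\<close>, given through evaluation so that each element comes with a
  polynomial; \<open>adjoin_least\<close> supplies the view as a least subring.\<close>

definition adjoin :: "'a::comm_ring_1 set \<Rightarrow> 'a \<Rightarrow> 'a set" where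
  "adjoin S x = (\<lambda>q. poly q x) ` poly_over S"

definition frac_set :: "'a::field set \<Rightarrow> 'a set" where
  "frac_set S = {y / z | y z. y \<in> S \<and> z \<in> S \<and> z \<noteq> 0}"

lemma is_subringD:
  assumes "is_subring S"
  shows "0 \<in> S" "1 \<in> S" "a \<in> S \<Longrightarrow> b \<in> S \<Longrightarrow> a + b \<in> S"
    "a \<in> S \<Longrightarrow> b \<in> S \<Longrightarrow> a * b \<in> S" "a \<in> S \<Longrightarrow> - a \<in> S"
    "a \<in> S \<Longrightarrow> b \<in> S \<Longrightarrow> a - b \<in> S"
proof -
  have "a + (- b) \<in> S" if "a \<in> S" "b \<in> S"
    using assms that unfolding is_subring_def by blast
  then show "a \<in> S \<Longrightarrow> b \<in> S \<Longrightarrow> a - b \<in> S" by simp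
qed (use assms in \<open>auto simp: is_subring_def\<close>)

lemma is_subfieldD:
  assumes "is_subfield F"
  shows "is_subring F" "a \<in> F \<Longrightarrow> inverse a \<in> F" "a \<in> F \<Longrightarrow> b \<in> F \<Longrightarrow> a / b \<in> F"
proof -
  have i: "inverse a \<in> F" if "a \<in> F" for a
    using assms that by (cases "a = 0") (auto simp: is_subfield_def is_subring_def)
  then show "a \<in> F \<Longrightarrow> inverse a \<in> F" .
  show "is_subring F" using assms by (simp add: is_subfield_def)
  then show "a \<in> F \<Longrightarrow> b \<in> F \<Longrightarrow> a / b \<in> F"
    using i by (auto simp: divide_inverse intro: is_subringD)
qed

lemma is_subring_sum:
  assumes "is_subring S" "\<And>i. i \<in> A \<Longrightarrow> f i \<in> S"
  shows "sum f A \<in> S"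
  using assms(2) by (induction A rule: infinite_finite_induct) (auto intro: is_subringD[OF assms(1)])

lemma is_subring_poly_over:
  assumes "is_subring S"
  shows "is_subring (poly_over S)"
  unfolding is_subring_def poly_over_def
  by (auto simp: coeff_mult of_bool_def intro!: is_subringD[OF assms] is_subring_sum[OF assms])

lemma is_subring_poly:
  assumes "is_subring S" "q \<in> poly_over S" "x \<in> S"
  shows "poly q x \<in> S"
proof -
  have "x ^ i \<in> S" for i
    by (induction i) (auto intro: is_subringD[OF assms(1)] assms(3))
  with assms show ?thesis
    by (auto simp: poly_altdef poly_over_def intro!: is_subring_sum is_subringD)
qed

lemma poly_over_const: "is_subring S \<Longrightarrow> c \<in> S \<Longrightarrow> [:c:] \<in> poly_over S"
  by (auto simp: poly_over_def coeff_pCons split: nat.split dest: is_subringD(1))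

lemma poly_over_X: "is_subring S \<Longrightarrow> [:0, 1:] \<in> poly_over S"
  by (auto simp: poly_over_def coeff_pCons split: nat.split dest: is_subringD(1,2))

lemma is_subring_adjoin:
  assumes "is_subring S"
  shows "is_subring (adjoin S x)"
proof -
  note p = is_subringD[OF is_subring_poly_over[OF assms]]
  have "0 = poly 0 x" "1 = poly 1 x" by simp_all
  then have "0 \<in> adjoin S x" "1 \<in> adjoin S x"
    unfolding adjoin_def using p by blast+
  moreover have "poly f x + poly g x \<in> adjoin S x \<and> poly f x * poly g x \<in> adjoin S x
      \<and> - poly f x \<in> adjoin S x"
    if "f \<in> poly_over S" "g \<in> poly_over S" for f g
    using p(3-5) that unfolding adjoin_def
    by (metis imageI poly_add poly_mult poly_minus)
  ultimately show ?thesis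
    unfolding is_subring_def by (auto simp: adjoin_def)
qed

lemma adjoin_superset: "is_subring S \<Longrightarrow> S \<subseteq> adjoin S x"
proof
  fix c assume "is_subring S" "c \<in> S"
  moreover have "c = poly [:c:] x" by simp
  ultimately show "c \<in> adjoin S x"
    unfolding adjoin_def using poly_over_const by blast
qed

lemma adjoin_generator: "is_subring S \<Longrightarrow> x \<in> adjoin S x"
  unfolding adjoin_def using poly_over_X by (intro image_eqI[where x = "[:0, 1:]"]) auto

lemma adjoin_least: "is_subring T \<Longrightarrow> S \<subseteq> T \<Longrightarrow> x \<in> T \<Longrightarrow> adjoin S x \<subseteq> T"
  unfolding adjoin_def poly_over_def by (auto intro!: is_subring_poly simp: poly_over_def subset_iff)

lemma frac_set_superset: "is_subring S \<Longrightarrow> S \<subseteq> frac_set S"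
  unfolding frac_set_def using is_subringD(2)[of S] by force

lemma frac_set_least: "is_subfield F \<Longrightarrow> S \<subseteq> F \<Longrightarrow> frac_set S \<subseteq> F"
  unfolding frac_set_def using is_subfieldD(3)[of F] by auto

lemma frac_setI: "y \<in> S \<Longrightarrow> z \<in> S \<Longrightarrow> z \<noteq> 0 \<Longrightarrow> y / z \<in> frac_set S"
  by (auto simp: frac_set_def)

lemma is_subfield_frac_set:
  assumes "is_subring S"
  shows "is_subfield (frac_set S)"
proof -
  note s = is_subringD[OF assms]
  have 01: "0 \<in> frac_set S" "1 \<in> frac_set S"
    using frac_set_superset[OF assms] s(1,2) by auto
  have cl: "a + b \<in> frac_set S \<and> a * b \<in> frac_set S \<and> - a \<in> frac_set S \<and> inverse a \<in> frac_set S"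
    if a: "a \<in> frac_set S" and b: "b \<in> frac_set S" for a b
  proof -
    obtain y z where yz: "a = y / z" "y \<in> S" "z \<in> S" "z \<noteq> 0"
      using a by (auto simp: frac_set_def)
    obtain y' z' where yz': "b = y' / z'" "y' \<in> S" "z' \<in> S" "z' \<noteq> 0"
      using b by (auto simp: frac_set_def)
    have "a + b = (y * z' + y' * z) / (z * z')" "a * b = (y * y') / (z * z')" "- a = (- y) / z"
      "inverse a = z / y"
      using yz yz' by (simp_all add: add_frac_eq)
    moreover have "inverse a = 0" if "y = 0"
      using that yz by simp
    moreover have "(y * z' + y' * z) / (z * z') \<in> frac_set S" "(y * y') / (z * z') \<in> frac_set S"
      "(- y) / z \<in> frac_set S" "y \<noteq> 0 \<Longrightarrow> z / y \<in> frac_set S"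
      using yz(2-4) yz'(2-4) by (intro frac_setI s; simp)+
    ultimately show ?thesis
      using 01(1) by (cases "y = 0") metis+
  qed
  show ?thesis
    unfolding is_subfield_def is_subring_def
  proof (intro conjI ballI impI)
  qed (use 01 cl in blast)+
qed

text \<open>Long division divides only by the leading coefficient of \<open>p\<close>, an element of
  \<open>F\<close>, so quotient and remainder keep their coefficients in \<open>F\<close>.\<close>

lemma poly_over_division:
  assumes F: "is_subfield F" and p: "p \<in> poly_over F" "p \<noteq> 0" and f: "f \<in> poly_over F"
  obtains q r where "q \<in> poly_over F" "r \<in> poly_over F" "f = q * p + r"
    "r = 0 \<or> degree r < degree p"
proof -
  note s = is_subfieldD(1)[OF F]
  note ps = is_subringD[OF is_subring_poly_over[OF s]]
  \<comment> \<open>Induction on a bound \<open>N\<close> above all nonzero coefficients of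
    \<open>f\<close>, rather than on the degree: the base case is then just
    \<open>f = 0\<close>.\<close>
  have "\<exists>q\<in>poly_over F. \<exists>r\<in>poly_over F. f = q * p + r \<and> (r = 0 \<or> degree r < degree p)"
    if "f \<in> poly_over F" "\<forall>i\<ge>N. coeff f i = 0" for N f
    using that
  proof (induction N arbitrary: f)
    case 0
    then have "f = 0" by (simp add: poly_eq_iff)
    then show ?case using ps(1) by force
  next
    case (Suc N)
    show ?case
    proof (cases "N < degree p")
      case True
      have "degree f \<le> N" using Suc.prems(2) by (intro degree_le) auto
      with True have "f = 0 * p + f" "degree f < degree p" by auto
      then show ?thesis using ps(1) Suc.prems(1) by blast
    next
      case False
      \<comment> \<open>The product \<open>t * p\<close> agrees with \<open>f\<close> at index
        \<open>N\<close> and has no coefficient above it.\<close>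
      define t where "t = monom (coeff f N / lead_coeff p) (N - degree p)"
      have t: "t \<in> poly_over F"
        using Suc.prems(1) p(1) is_subringD(1)[OF s] is_subfieldD(3)[OF F]
        by (auto simp: t_def poly_over_def)
      have z: "coeff (f - t * p) i = 0" if "i \<ge> N" for i
      proof (cases "i = N")
        case True
        then show ?thesis using False p(2) by (simp add: t_def coeff_monom_mult)
      next
        case i: False
        then have "coeff p (i - (N - degree p)) = 0"
          using that False by (intro coeff_eq_0) auto
        then show ?thesis using that i Suc.prems(2) by (simp add: t_def coeff_monom_mult)
      qed
      obtain q r where q: "q \<in> poly_over F" "r \<in> poly_over F" "f - t * p = q * p + r"
        "r = 0 \<or> degree r < degree p"
        using Suc.IH[OF ps(6)[OF Suc.prems(1) ps(4)[OF t p(1)]]] z by blast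
      have "f = (q + t) * p + r" using q(3) by (simp add: algebra_simps)
      then show ?thesis using q(2,4) ps(3)[OF q(1) t] by blast
    qed
  qed
  from this[OF f, of "Suc (degree f)"] show ?thesis
    using that by (auto simp: coeff_eq_0)
qed

section \<open>Ring homomorphisms and substitution into polynomials\<close>

locale comm_ring_hom_fun =
  fixes h :: "'a::comm_ring_1 \<Rightarrow> 'b::comm_ring_1"
  assumes hom_one: "h 1 = 1"
    and hom_add: "h (a + b) = h a + h b"
    and hom_mult: "h (a * b) = h a * h b"
begin

lemma hom_zero: "h 0 = 0"
  using hom_add[of 0 0] by simp

lemma hom_minus: "h (- a) = - h a"
  using hom_add[of a "- a"] by (simp add: hom_zero eq_neg_iff_add_eq_0 add.commute)

lemma hom_poly: "h (poly q x) = poly (map_poly h q) (h x)"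
  by (induction q) (auto simp: hom_zero hom_add hom_mult map_poly_pCons)

end

lemma mpoly_induct [case_names single add]:
  fixes f :: "'a \<Rightarrow>\<^sub>0 'b::comm_monoid_add"
  assumes single: "\<And>m c. P (Poly_Mapping.single m c)"
    and add: "\<And>f g. P f \<Longrightarrow> P g \<Longrightarrow> P (f + g)"
  shows "P f"
proof (induction f rule: update_induct)
  case const
  \<comment> \<open>The zero polynomial is a monomial with coefficient \<open>0\<close> at an
    arbitrary index.\<close>
  then show ?case using single[of undefined 0] by (simp add: single_zero)
next
  case (update f a b)
  then have "Poly_Mapping.update a b f = f + Poly_Mapping.single a b"
    by (intro poly_mapping_eqI) (auto simp: lookup_update lookup_add lookup_single when_def in_keys_iff)
  then show ?case using update single add by simp
qed

definition mono_eval :: "(nat \<Rightarrow> 'b::comm_semiring_1) \<Rightarrow> multiindex \<Rightarrow> 'b" where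
  "mono_eval p m = (\<Prod>j \<in> Poly_Mapping.keys m. p j ^ Poly_Mapping.lookup m j)"

text \<open>Outside the support of \<open>m\<close> the factors are \<open>p j ^ 0 = 1\<close>. Two
  multi-indices can thus be evaluated over one common set of variables.\<close>

lemma mono_eval_superset:
  assumes "finite S" "Poly_Mapping.keys m \<subseteq> S"
  shows "mono_eval p m = (\<Prod>j\<in>S. p j ^ Poly_Mapping.lookup m j)"
  unfolding mono_eval_def using assms
  by (intro prod.mono_neutral_left) (auto simp: in_keys_iff)

lemma mono_eval_add: "mono_eval p (m + m') = mono_eval p m * mono_eval p m'"
proof -
  let ?S = "Poly_Mapping.keys m \<union> Poly_Mapping.keys m'"
  have "Poly_Mapping.keys (m + m') \<subseteq> ?S" by (rule Poly_Mapping.keys_add)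
  then show ?thesis
    by (simp add: mono_eval_superset[of ?S] lookup_add power_add prod.distrib)
qed

context comm_ring_hom_fun
begin

lemma mv_subst_superset:
  assumes "finite S" "Poly_Mapping.keys g \<subseteq> S"
  shows "mv_subst h p g = (\<Sum>m\<in>S. h (Poly_Mapping.lookup g m) * mono_eval p m)"
  unfolding mv_subst_def mono_eval_def using assms
  by (intro sum.mono_neutral_left) (auto simp: in_keys_iff hom_zero)

lemma mv_subst_add: "mv_subst h p (f + g) = mv_subst h p f + mv_subst h p g"
proof -
  let ?S = "Poly_Mapping.keys f \<union> Poly_Mapping.keys g"
  have "Poly_Mapping.keys (f + g) \<subseteq> ?S" by (rule Poly_Mapping.keys_add)
  then show ?thesis
    by (simp add: mv_subst_superset[of ?S] lookup_add hom_add algebra_simps sum.distrib)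
qed

lemma mv_subst_single: "mv_subst h p (Poly_Mapping.single m c) = h c * mono_eval p m"
  by (subst mv_subst_superset[of "{m}"]) (auto split: if_splits)

text \<open>Both sides are additive in \<open>f\<close> and in \<open>g\<close>, which leaves
  products of two monomials.\<close>

lemma mv_subst_mult: "mv_subst h p (f * g) = mv_subst h p f * mv_subst h p g"
proof (induction f rule: mpoly_induct)
  case (single m c)
  show ?case
  proof (induction g rule: mpoly_induct)
    case (single m' c')
    show ?case
      by (simp add: mult_single mv_subst_single hom_mult mono_eval_add algebra_simps)
  qed (simp add: distrib_left mv_subst_add)
qed (simp add: distrib_right mv_subst_add)

lemma mv_subst_const: "mv_subst h p (mv_const c) = h c"
  by (simp add: mv_const_def mv_subst_single mono_eval_def)

lemma mv_subst_var: "mv_subst h p (mv_var j) = p j"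
  by (simp add: mv_var_def mv_subst_single mono_eval_def hom_one)

lemma comm_ring_hom_mv_subst: "comm_ring_hom_fun (mv_subst h p)"
  using mv_subst_const[of p 1]
  by unfold_locales (simp_all add: mv_subst_add mv_subst_mult mv_const_def hom_one)

end

subsection \<open>Polynomials over a subring and their partial derivatives\<close>

text \<open>The zero multi-index splits only as \<open>0 + 0\<close>, so constant terms
  multiply.\<close>

lemma lookup_mult_zero:
  fixes f g :: "'a::comm_ring_1 mvpoly"
  shows "Poly_Mapping.lookup (f * g) 0 = Poly_Mapping.lookup f 0 * Poly_Mapping.lookup g 0"
proof (induction f rule: mpoly_induct)
  case (single m c)
  show ?case
  proof (induction g rule: mpoly_induct)
    case (single m' c')
    have "m + m' = 0 \<longleftrightarrow> m = 0 \<and> m' = 0"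
      by (auto simp: poly_mapping_eq_iff lookup_add fun_eq_iff)
    then show ?case
      by (auto simp: mult_single lookup_single when_def)
  qed (simp add: distrib_left lookup_add)
qed (simp add: distrib_right lookup_add)

lemma multiindex_add_eq_single:
  fixes m m' :: multiindex
  shows "m + m' = Poly_Mapping.single j 1 \<longleftrightarrow>
    m = 0 \<and> m' = Poly_Mapping.single j 1 \<or> m = Poly_Mapping.single j 1 \<and> m' = 0"
proof
  assume *: "m + m' = Poly_Mapping.single j 1"
  then have l: "Poly_Mapping.lookup m i + Poly_Mapping.lookup m' i = (1 when j = i)" for i
    by (metis lookup_add lookup_single)
  have o: "Poly_Mapping.lookup m i = 0 \<and> Poly_Mapping.lookup m' i = 0" if "i \<noteq> j" for i
    using l[of i] that by simp
  have "Poly_Mapping.lookup m j = 0 \<or> Poly_Mapping.lookup m' j = 0"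
    using l[of j] by auto
  then have "m = 0 \<or> m' = 0"
    using o by (metis lookup_zero poly_mapping_eqI)
  then show "m = 0 \<and> m' = Poly_Mapping.single j 1 \<or> m = Poly_Mapping.single j 1 \<and> m' = 0"
    using * by auto
qed auto

lemma single_1_neq_0: "Poly_Mapping.single j 1 \<noteq> (0::multiindex)"
  by (metis lookup_single_eq lookup_zero zero_neq_one)

text \<open>Only the splittings \<open>0 + e\<close> and \<open>e + 0\<close> contribute. Applied to
  shifted polynomials, this becomes the Leibniz rule \<open>mv_partial_mult\<close>.\<close>

lemma lookup_mult_single:
  fixes f g :: "'a::comm_ring_1 mvpoly" and j :: nat
  defines "e \<equiv> Poly_Mapping.single j (1::nat)"
  shows "Poly_Mapping.lookup (f * g) e =
    Poly_Mapping.lookup f 0 * Poly_Mapping.lookup g e + Poly_Mapping.lookup f e * Poly_Mapping.lookup g 0"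
proof (induction f rule: mpoly_induct)
  case (single m c)
  have e: "e \<noteq> 0" unfolding e_def by (rule single_1_neq_0)
  show ?case
  proof (induction g rule: mpoly_induct)
    case (single m' c')
    have "m + m' = e \<longleftrightarrow> m = 0 \<and> m' = e \<or> m = e \<and> m' = 0"
      unfolding e_def by (rule multiindex_add_eq_single)
    then show ?case
      using e by (auto simp: mult_single lookup_single when_def)
  qed (simp add: distrib_left lookup_add algebra_simps)
qed (simp add: distrib_right lookup_add algebra_simps)

lemma mv_const_add: "mv_const (a + b) = mv_const a + mv_const b"
  by (simp add: mv_const_def single_add)

lemma mv_const_mult: "mv_const (a * b :: 'a::comm_ring_1) = mv_const a * mv_const b"
  by (simp add: mv_const_def mult_single)

lemma mv_const_one: "mv_const (1::'a::comm_ring_1) = 1"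
  by (simp add: mv_const_def)

interpretation mv_shift_coeff: comm_ring_hom_fun "\<lambda>c::'a::comm_ring_1. mv_const (mv_const c)"
  by unfold_locales (simp_all add: mv_const_add mv_const_mult mv_const_one)

lemma
  shows mv_shift_add: "mv_shift (f + g) = mv_shift f + mv_shift g"
    and mv_shift_mult: "mv_shift (f * g) = mv_shift f * mv_shift g"
    and mv_shift_const: "mv_shift (mv_const c) = mv_const (mv_const c)"
    and mv_shift_var: "mv_shift (mv_var j) = mv_const (mv_var j) + mv_var j"
  by (simp_all add: mv_shift_def mv_shift_coeff.mv_subst_add mv_shift_coeff.mv_subst_mult
      mv_shift_coeff.mv_subst_const mv_shift_coeff.mv_subst_var)

text \<open>
  \<open>mv_gen E n\<close> is $E[x_0,\dots,x_{n-1}]$: only the variables below \<open>n\<close> occur, whereas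
  \<open>mvpolys n\<close> also admits $x_n$.
\<close>

inductive_set mv_gen :: "'a::comm_ring_1 set \<Rightarrow> nat \<Rightarrow> 'a mvpoly set" for E n where
  const: "c \<in> E \<Longrightarrow> mv_const c \<in> mv_gen E n"
| var: "j < n \<Longrightarrow> mv_var j \<in> mv_gen E n"
| add: "f \<in> mv_gen E n \<Longrightarrow> g \<in> mv_gen E n \<Longrightarrow> f + g \<in> mv_gen E n"
| mult: "f \<in> mv_gen E n \<Longrightarrow> g \<in> mv_gen E n \<Longrightarrow> f * g \<in> mv_gen E n"

lemma is_subring_mv_gen:
  fixes E :: "'a::comm_ring_1 set"
  assumes "is_subring E"
  shows "is_subring (mv_gen E n)"
proof -
  note s = is_subringD[OF assms]
  have "mv_const 0 = (0 :: 'a mvpoly)" "mv_const 1 = (1 :: 'a mvpoly)" by (simp_all add: mv_const_def)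
  then have "0 \<in> mv_gen E n" "1 \<in> mv_gen E n"
    using s(1,2) mv_gen.const by metis+
  moreover have "- f \<in> mv_gen E n" if "f \<in> mv_gen E n" for f
  proof -
    have "- f = mv_const (- 1) * f"
      by (simp add: mv_const_def single_uminus)
    then show ?thesis using that s(2,5) by (auto intro: mv_gen.mult mv_gen.const)
  qed
  ultimately show ?thesis
    unfolding is_subring_def by (auto intro: mv_gen.add mv_gen.mult)
qed

lemma mv_gen_mono: "n \<le> m \<Longrightarrow> mv_gen E n \<subseteq> mv_gen E m"
proof
  fix g assume "n \<le> m" "g \<in> mv_gen E n"
  from this(2,1) show "g \<in> mv_gen E m"
    by induction (auto intro: mv_gen.intros)
qed

text \<open>Reads a polynomial in one more variable as a univariate polynomial in
  \<open>mv_var n\<close>, which makes degree and \<open>pderiv\<close> in the last variable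
  available.\<close>

lemma mv_gen_Suc:
  assumes "is_subring E"
  shows "mv_gen E (Suc n) = adjoin (mv_gen E n) (mv_var n)"
proof
  note m = is_subring_mv_gen[OF assms, of n]
  note a = is_subring_adjoin[OF m, of "mv_var n"]
  show "mv_gen E (Suc n) \<subseteq> adjoin (mv_gen E n) (mv_var n)"
  proof
    fix g assume "g \<in> mv_gen E (Suc n)"
    then show "g \<in> adjoin (mv_gen E n) (mv_var n)"
    proof induction
      case (const c)
      then show ?case using adjoin_superset[OF m] mv_gen.const by blast
    next
      case (var j)
      then show ?case using adjoin_superset[OF m] adjoin_generator[OF m] mv_gen.var[of j n E]
        by (cases "j = n") auto
    qed (auto intro: is_subringD[OF a])
  qed
  show "adjoin (mv_gen E n) (mv_var n) \<subseteq> mv_gen E (Suc n)"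
    by (rule adjoin_least[OF is_subring_mv_gen[OF assms]])
      (use mv_gen_mono[of n "Suc n"] mv_gen.var[of n "Suc n"] in auto)
qed

text \<open>The index drops by one because \<open>mvpolys n\<close> already admits the variable
  \<open>n\<close>. With \<open>lookup_mv_gen\<close> this gives what \<open>sigma_henselian\<close>
  asks of a polynomial.\<close>

lemma mv_gen_mvpolys: "g \<in> mv_gen E (Suc n) \<Longrightarrow> g \<in> mvpolys n"
proof (induction rule: mv_gen.induct)
  case (add f g)
  then show ?case
    using Poly_Mapping.keys_add[of f g] by (fastforce simp: mvpolys_def)
next
  case (mult f g)
  have "Poly_Mapping.keys m \<subseteq> {..n}" if m: "m \<in> Poly_Mapping.keys (f * g)" for m
  proof -
    obtain a b where ab: "m = a + b" "a \<in> Poly_Mapping.keys f" "b \<in> Poly_Mapping.keys g"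
      using keys_mult[of f g] m by auto
    then have "Poly_Mapping.keys a \<subseteq> {..n}" "Poly_Mapping.keys b \<subseteq> {..n}"
      using mult.IH by (auto simp: mvpolys_def)
    then show ?thesis
      using Poly_Mapping.keys_add[of a b] unfolding ab(1) by blast
  qed
  then show ?case by (auto simp: mvpolys_def)
qed (auto simp: mvpolys_def mv_const_def mv_var_def split: if_splits)

lemma lookup_mv_gen:
  assumes E: "is_subring E" and "g \<in> mv_gen E n"
  shows "Poly_Mapping.lookup g m \<in> E"
  using assms(2)
proof (induction arbitrary: m)
  case (mult f g)
  show ?case
    \<comment> \<open>The convolution unfolds to sums over the nonzero terms, whose entries are
      coefficients in \<open>E\<close> or the default value \<open>0\<close> of
      \<open>when\<close>.\<close>
    unfolding lookup_mult Sum_any.expand_set when_def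
    by (intro is_subring_sum[OF E] is_subringD(4)[OF E]) (auto simp: mult.IH is_subringD(1)[OF E])
qed (auto simp: mv_const_def mv_var_def lookup_single when_def lookup_add is_subringD[OF E])

text \<open>Setting the shift variables to zero returns \<open>g\<close>. Membership in
  \<open>mv_gen\<close> provides the induction along constants, variables, sums and
  products.\<close>

lemma lookup_mv_shift_zero: "g \<in> mv_gen E n \<Longrightarrow> Poly_Mapping.lookup (mv_shift g) 0 = g"
proof (induction rule: mv_gen.induct)
  case (var j)
  show ?case
    using single_1_neq_0[of j]
    by (simp add: mv_shift_var lookup_add) (simp add: mv_const_def mv_var_def lookup_single when_def)
qed (simp_all add: mv_shift_const mv_shift_add mv_shift_mult lookup_add lookup_mult_zero,
    simp add: mv_const_def)

text \<open>The formal derivative in the variable \<open>j\<close>, taken as a linear Taylor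
  coefficient because \<open>sigma_henselian\<close> is phrased with these.\<close>

definition mv_partial :: "nat \<Rightarrow> 'a::comm_ring_1 mvpoly \<Rightarrow> 'a mvpoly" where
  "mv_partial j = mv_taylor (Poly_Mapping.single j 1)"

lemma mv_partial_add: "mv_partial j (f + g) = mv_partial j f + mv_partial j g"
  by (simp add: mv_partial_def mv_taylor_def mv_shift_add lookup_add)

lemma mv_partial_mult:
  assumes "f \<in> mv_gen E n" "g \<in> mv_gen E n"
  shows "mv_partial j (f * g) = f * mv_partial j g + mv_partial j f * g"
  using assms by (simp add: mv_partial_def mv_taylor_def mv_shift_mult lookup_mult_single[simplified] lookup_mv_shift_zero)

lemma mv_partial_const: "mv_partial j (mv_const c) = 0"
  using single_1_neq_0[of j]
  by (simp add: mv_partial_def mv_taylor_def mv_shift_const) (simp add: mv_const_def lookup_single when_def)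

lemma mv_partial_var: "mv_partial j (mv_var i) = (if i = j then 1 else 0)"
proof -
  have "Poly_Mapping.single i 1 = (Poly_Mapping.single j 1 :: multiindex) \<longleftrightarrow> i = j"
    by (metis lookup_single_eq lookup_single_not_eq zero_neq_one)
  then show ?thesis
    using single_1_neq_0[of j]
    by (simp add: mv_partial_def mv_taylor_def mv_shift_var lookup_add)
      (simp add: mv_const_def mv_var_def lookup_single when_def)
qed

lemma mv_partial_mv_gen:
  assumes "is_subring E" "g \<in> mv_gen E n"
  shows "mv_partial j g \<in> mv_gen E n"
  using assms(2)
proof induction
  case (mult f g)
  then show ?case
    by (subst mv_partial_mult) (auto intro: mv_gen.intros)
qed (use is_subringD(1,2)[OF is_subring_mv_gen[OF assms(1)]] in
    \<open>auto simp: mv_partial_const mv_partial_var mv_partial_add intro: mv_gen.intros\<close>)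

lemma mv_partial_eq_0: "g \<in> mv_gen E n \<Longrightarrow> mv_partial n g = 0"
proof (induction rule: mv_gen.induct)
  case (mult f g)
  then show ?case by (subst mv_partial_mult) auto
qed (auto simp: mv_partial_const mv_partial_var mv_partial_add)

text \<open>The coefficients of \<open>q\<close> do not contain the variable \<open>n\<close>, so
  \<open>mv_partial n\<close> kills them and the Leibniz rule yields the recursion of
  \<open>pderiv\<close>.\<close>

lemma mv_partial_poly:
  fixes E :: "'a::field set"
  assumes E: "is_subring E" and "q \<in> poly_over (mv_gen E n)"
  shows "mv_partial n (poly q (mv_var n)) = poly (pderiv q) (mv_var n)"
  using assms(2)
proof (induction q)
  case 0
  have "mv_partial n (0 :: 'a mvpoly) = 0"
    using mv_partial_const[of n 0] by (simp add: mv_const_def)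
  then show ?case by simp
next
  case (pCons c q)
  have c: "c \<in> mv_gen E n"
    using pCons.prems by (auto simp: poly_over_def dest: spec[of _ 0])
  have q: "q \<in> poly_over (mv_gen E n)"
    using pCons.prems by (auto simp: poly_over_def coeff_pCons dest: spec[of _ "Suc _"])
  have "poly q (mv_var n) \<in> mv_gen E (Suc n)"
    using q unfolding mv_gen_Suc[OF E] adjoin_def by blast
  then have "mv_partial n (mv_var n * poly q (mv_var n)) =
      mv_var n * mv_partial n (poly q (mv_var n)) + poly q (mv_var n)"
    by (subst mv_partial_mult[of _ E "Suc n"]) (auto simp: mv_partial_var intro: mv_gen.var)
  then show ?case
    using pCons.IH[OF q] mv_partial_eq_0[OF c]
    by (simp add: mv_partial_add pderiv_pCons algebra_simps)
qed

subsection \<open>Trivially valued subfields\<close>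

lemma (in comm_ring_hom_fun) is_subring_image:
  assumes "is_subring S"
  shows "is_subring (h ` S)"
proof -
  note s = is_subringD[OF assms]
  have "h a + h b \<in> h ` S" "h a * h b \<in> h ` S" "- h a \<in> h ` S" if "a \<in> S" "b \<in> S" for a b
    using s(3-5) that by (metis imageI hom_add hom_mult hom_minus)+
  moreover have "0 \<in> h ` S" "1 \<in> h ` S"
    using s(1,2) by (metis imageI hom_zero hom_one)+
  ultimately show ?thesis
    unfolding is_subring_def by (auto simp: image_iff)
qed

lemma difference_subfield_iff: "difference_subfield \<sigma> F \<longleftrightarrow> is_subfield F \<and> \<sigma> ` F = F"
  unfolding difference_subfield_def is_subfield_def is_subring_def by blast

interpretation identity: comm_ring_hom_fun "\<lambda>c::'a::comm_ring_1. c"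
  by unfold_locales auto

interpretation sigma_eval: comm_ring_hom_fun "\<lambda>g. sigma_eval \<sigma> g c"
  unfolding sigma_eval_def by (rule identity.comm_ring_hom_mv_subst)

lemma sigma_eval_const [simp]: "sigma_eval \<sigma> (mv_const e :: 'a::comm_ring_1 mvpoly) c = e"
  and sigma_eval_var [simp]: "sigma_eval \<sigma> (mv_var j :: 'a mvpoly) c = (\<sigma> ^^ j) c"
  unfolding sigma_eval_def by (simp_all add: identity.mv_subst_const identity.mv_subst_var)

context valued_difference_field
begin

sublocale sigma: comm_ring_hom_fun \<sigma>
  by unfold_locales (simp_all add: sigma_one sigma_add sigma_mult)

lemma v_one: "v 1 = 0"
  using v_mult[of 1 1] by simp

text \<open>The square of \<open>- 1\<close> is \<open>1\<close>, and an ordered group has no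
  element of order two.\<close>

lemma v_minus_one: "v (- 1) = 0"
  using v_mult[of "- 1" "- 1"] v_one by simp

lemma val_ring_iff: "a \<in> val_ring v \<longleftrightarrow> a = 0 \<or> 0 \<le> v a"
  by (simp add: val_ring_def val_def zero_extended_def)

lemma is_subring_val_ring: "is_subring (val_ring v)"
proof -
  have "a + b \<in> val_ring v" if "a \<in> val_ring v" "b \<in> val_ring v" for a b
    using that order_trans[of 0 "min (v a) (v b)" "v (a + b)"] v_add[of a b]
    unfolding val_ring_iff min.bounded_iff by (cases "a = 0 \<or> b = 0 \<or> a + b = 0") auto
  moreover have "a * b \<in> val_ring v" if "a \<in> val_ring v" "b \<in> val_ring v" for a b
    using that v_mult[of a b] by (cases "a = 0 \<or> b = 0") (auto simp: val_ring_iff)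
  moreover have "- a \<in> val_ring v" if "a \<in> val_ring v" for a
    using that v_mult[of "- 1" a] v_minus_one by (cases "a = 0") (auto simp: val_ring_iff)
  ultimately show ?thesis
    by (auto simp: is_subring_def val_ring_iff v_one)
qed

lemmas val_ringD = is_subringD[OF is_subring_val_ring]

lemma res_zero: "\<pi> 0 = 0"
  using res_eq_0_iff[OF val_ringD(1)] by (simp add: val_def zero_extended_def)

lemma res_diff:
  assumes "a \<in> val_ring v" "b \<in> val_ring v"
  shows "\<pi> (a - b) = \<pi> a - \<pi> b"
  using res_add[of "a - b" b] val_ringD(6)[OF assms] assms by (simp add: algebra_simps)

lemma val_eq_0_of_res:
  assumes "a \<in> val_ring v" "\<pi> a \<noteq> 0"
  shows "val v a = 0"
  using assms res_eq_0_iff[OF assms(1)] by (auto simp: val_ring_def)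

lemma inverse_val_ring:
  assumes "a \<in> val_ring v" "\<pi> a \<noteq> 0"
  shows "inverse a \<in> val_ring v"
proof -
  have a: "a \<noteq> 0" using assms res_zero by auto
  then have "v a = 0"
    using val_eq_0_of_res[OF assms] by (simp add: val_def zero_extended_def)
  then have "v (inverse a) = 0"
    using v_mult[of a "inverse a"] a v_one by simp
  then show ?thesis by (simp add: val_ring_iff)
qed

text \<open>A nonzero \<open>a\<close> has its inverse in \<open>F\<close> and hence in the
  valuation ring, so its residue is invertible. Triviality of the valuation on \<open>F\<close> is
  used in this form.\<close>

lemma res_eq_0_subfield:
  assumes "is_subfield F" "F \<subseteq> val_ring v" "a \<in> F" "\<pi> a = 0"
  shows "a = 0"
proof (rule ccontr)
  assume "a \<noteq> 0"
  have "a \<in> val_ring v" "inverse a \<in> val_ring v"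
    using assms is_subfieldD(2) by blast+
  then have "\<pi> (a * inverse a) = 0" using assms(4) by (simp add: res_mult)
  then show False using \<open>a \<noteq> 0\<close> by (simp add: res_one)
qed

text \<open>Nonzero denominators have nonzero residue, so they are units of the valuation
  ring.\<close>

lemma frac_set_val_ring:
  assumes "S \<subseteq> val_ring v" "\<And>x. x \<in> S \<Longrightarrow> \<pi> x = 0 \<Longrightarrow> x = 0"
  shows "frac_set S \<subseteq> val_ring v"
  using assms inverse_val_ring unfolding frac_set_def
  by (auto simp: divide_inverse intro!: val_ringD(4))

text \<open>
  A polynomial \<open>m\<close> of least degree with \<open>\<pi> (m x) = 0\<close> divides all such polynomials. If \<open>m x\<close> were
  nonzero, cancelling it from an annihilator of \<open>x\<close> of least degree would lower that degree.
\<close>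

lemma res_eq_0_adjoin_algebraic:
  assumes F: "is_subfield F" "F \<subseteq> val_ring v" and x: "x \<in> val_ring v"
    and p: "p \<in> poly_over F" "p \<noteq> 0" "poly p x = 0"
    and y: "y \<in> adjoin F x" "\<pi> y = 0"
  shows "y = 0"
proof -
  note s = is_subfieldD(1)[OF F(1)]
  define A where "A = {f \<in> poly_over F. f \<noteq> 0 \<and> \<pi> (poly f x) = 0}"
  have val: "poly f x \<in> val_ring v" if "f \<in> poly_over F" for f
    using that F(2) x by (intro is_subring_poly[OF is_subring_val_ring]) (auto simp: poly_over_def)
  have "p \<in> A" using p res_zero by (simp add: A_def)
  then obtain m where m: "m \<in> A" and m_min: "\<And>f. f \<in> A \<Longrightarrow> degree m \<le> degree f"
    using ex_has_least_nat[of "\<lambda>f. f \<in> A" p degree] by blast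
  have dvd: "\<exists>q\<in>poly_over F. f = q * m" if f: "f \<in> poly_over F" "\<pi> (poly f x) = 0" for f
  proof -
    obtain q r where q: "q \<in> poly_over F" "r \<in> poly_over F" "f = q * m + r"
      "r = 0 \<or> degree r < degree m"
      using poly_over_division[OF F(1) _ _ f(1), of m] m by (auto simp: A_def)
    have "poly r x = poly f x - poly q x * poly m x" using q(3) by simp
    then have "\<pi> (poly r x) = 0"
      using f m val q(1,2) by (simp add: res_diff res_mult val_ringD(4) A_def)
    then have "r = 0" using q m_min[of r] by (force simp: A_def)
    then show ?thesis using q by auto
  qed
  \<comment> \<open>A constant in \<open>A\<close> would be a nonzero element of \<open>F\<close>
    with zero residue.\<close>
  have "degree m > 0"
  proof (rule ccontr)
    assume "\<not> degree m > 0"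
    then obtain c where c: "m = [:c:]" by (metis degree_eq_zeroE gr0I)
    then have "c \<in> F" using m by (auto simp: A_def poly_over_def dest: spec[of _ 0])
    then show False
      using m c res_eq_0_subfield[OF F] by (auto simp: A_def)
  qed
  obtain f where f: "f \<in> poly_over F" "f \<noteq> 0" "poly f x = 0"
    and f_min: "\<And>g. g \<in> poly_over F \<Longrightarrow> g \<noteq> 0 \<Longrightarrow> poly g x = 0 \<Longrightarrow> degree f \<le> degree g"
    using ex_has_least_nat[of "\<lambda>f. f \<in> poly_over F \<and> f \<noteq> 0 \<and> poly f x = 0" p degree] p by blast
  obtain q where q: "q \<in> poly_over F" "f = q * m"
    using dvd[OF f(1)] f(3) res_zero by auto
  then have "q \<noteq> 0" "m \<noteq> 0" using f(2) by auto
  then have "degree q < degree f" using q(2) \<open>degree m > 0\<close> by (simp add: degree_mult_eq)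
  then have "poly q x \<noteq> 0" using f_min[OF q(1) \<open>q \<noteq> 0\<close>] by auto
  then have "poly m x = 0" using f(3) q(2) by simp
  moreover obtain g where "g \<in> poly_over F" "y = poly g x"
    using y(1) by (auto simp: adjoin_def)
  ultimately show ?thesis
    using dvd[of g] y(2) by auto
qed

section \<open>The automorphism on residues and on subfields\<close>

lemma sigma_eq_0_iff: "\<sigma> a = 0 \<longleftrightarrow> a = 0"
  using sigma.hom_zero bij_is_inj[OF sigma_bij] by (metis injD)

lemma val_sigma: "val v (\<sigma> a) = val v a"
  by (simp add: val_def sigma_eq_0_iff v_sigma)

lemma sigma_in_val_ring_iff: "\<sigma> a \<in> val_ring v \<longleftrightarrow> a \<in> val_ring v"
  by (simp add: val_ring_def val_sigma)

lemma sigma_funpow_in_val_ring_iff: "(\<sigma> ^^ j) a \<in> val_ring v \<longleftrightarrow> a \<in> val_ring v"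
  by (induction j) (auto simp: sigma_in_val_ring_iff)

text \<open>\<sigma> preserves the valuation and hence the maximal ideal. This congruence stands in
  for the induced map on the residue field.\<close>

lemma sigma_res_cong:
  assumes "a \<in> val_ring v" "b \<in> val_ring v" "\<pi> a = \<pi> b"
  shows "\<pi> (\<sigma> a) = \<pi> (\<sigma> b)"
proof -
  have "0 < val v (a - b)"
    using assms by (subst res_eq_0_iff[symmetric]) (simp_all add: res_diff val_ringD(6))
  then have "0 < val v (\<sigma> a - \<sigma> b)"
    using val_sigma[of "a - b"] sigma_add[of "a - b" b] by simp
  then have "\<pi> (\<sigma> a - \<sigma> b) = 0"
    using assms by (subst res_eq_0_iff) (simp_all add: sigma_in_val_ring_iff val_ringD(6))
  then show ?thesis
    using assms by (simp add: res_diff sigma_in_val_ring_iff)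
qed

lemma sigma_funpow_res_cong:
  assumes "a \<in> val_ring v" "b \<in> val_ring v" "\<pi> a = \<pi> b"
  shows "\<pi> ((\<sigma> ^^ j) a) = \<pi> ((\<sigma> ^^ j) b)"
  using assms by (induction j) (auto simp: sigma_funpow_in_val_ring_iff intro: sigma_res_cong)

lemma sigma_eval_val_ring:
  assumes "E \<subseteq> val_ring v" "c \<in> val_ring v" "g \<in> mv_gen E n"
  shows "sigma_eval \<sigma> g c \<in> val_ring v"
  using assms(3) assms(1,2)
  by induction (auto simp: sigma_eval.hom_add sigma_eval.hom_mult sigma_funpow_in_val_ring_iff
      intro: val_ringD)

text \<open>Allows a lift to be replaced by another of the same residue without changing the
  residues of \<sigma>-polynomials.\<close>

lemma sigma_eval_res_cong:
  assumes E: "E \<subseteq> val_ring v" and c: "c \<in> val_ring v" "d \<in> val_ring v" "\<pi> c = \<pi> d"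
    and "g \<in> mv_gen E n"
  shows "\<pi> (sigma_eval \<sigma> g c) = \<pi> (sigma_eval \<sigma> g d)"
  using assms(5)
  by induction (auto simp: sigma_eval.hom_add sigma_eval.hom_mult res_add res_mult
      sigma_eval_val_ring[OF E] c sigma_funpow_res_cong[OF c])

text \<open>\<sigma> acts on the coefficients and shifts each variable to the next one, so the image
  needs one variable more.\<close>

lemma sigma_eval_step:
  assumes E: "\<sigma> ` E \<subseteq> E" and g: "g \<in> mv_gen E n"
  shows "\<sigma> (sigma_eval \<sigma> g c) \<in> (\<lambda>g. sigma_eval \<sigma> g c) ` mv_gen E (Suc n)"
  using g
proof induction
  case (const e)
  then show ?case
    using E by (intro image_eqI[where x = "mv_const (\<sigma> e)"]) (auto intro: mv_gen.const)
next
  case (var j)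
  then show ?case
    by (intro image_eqI[where x = "mv_var (Suc j)"]) (auto intro: mv_gen.var)
next
  case (add f g)
  then obtain f' g' where "f' \<in> mv_gen E (Suc n)" "\<sigma> (sigma_eval \<sigma> f c) = sigma_eval \<sigma> f' c"
    "g' \<in> mv_gen E (Suc n)" "\<sigma> (sigma_eval \<sigma> g c) = sigma_eval \<sigma> g' c" by blast
  then show ?case
    by (intro image_eqI[where x = "f' + g'"])
      (auto simp: sigma_eval.hom_add sigma_add intro: mv_gen.add)
next
  case (mult f g)
  then obtain f' g' where "f' \<in> mv_gen E (Suc n)" "\<sigma> (sigma_eval \<sigma> f c) = sigma_eval \<sigma> f' c"
    "g' \<in> mv_gen E (Suc n)" "\<sigma> (sigma_eval \<sigma> g c) = sigma_eval \<sigma> g' c" by blast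
  then show ?case
    by (intro image_eqI[where x = "f' * g'"])
      (auto simp: sigma_eval.hom_mult sigma_mult intro: mv_gen.mult)
qed

lemma sigma_frac_set:
  assumes "is_subfield F" "\<sigma> ` S \<subseteq> F"
  shows "\<sigma> ` frac_set S \<subseteq> F"
proof -
  have d: "\<sigma> (y / z) = \<sigma> y / \<sigma> z" if "z \<noteq> 0" for y z
    using sigma_mult[of "y / z" z] that by (simp add: sigma_eq_0_iff field_simps)
  show ?thesis
    using assms(2) unfolding frac_set_def by (auto simp: d image_subset_iff intro!: is_subfieldD(3)[OF assms(1)])
qed

lemma sigma_adjoin:
  assumes "is_subring T" "\<sigma> ` S \<subseteq> T" "\<sigma> x \<in> T"
  shows "\<sigma> ` adjoin S x \<subseteq> T"
  using assms(1,3) subsetD[OF assms(2)] unfolding adjoin_def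
  by (auto simp: sigma.hom_poly poly_over_def coeff_map_poly sigma.hom_zero intro!: is_subring_poly)

text \<open>The union of the chain is closed under \<open>\<sigma>\<close> only; \<open>L\<close> consists of its preimages under all powers of \<open>\<sigma>\<close>.\<close>

lemma difference_subfield_of_chain:
  assumes F: "\<And>m. is_subfield (F m)" "\<And>m. F m \<subseteq> val_ring v"
    and mono: "\<And>m. F m \<subseteq> F (Suc m)" and sig: "\<And>m. \<sigma> ` F m \<subseteq> F (Suc m)"
  obtains L where "difference_subfield \<sigma> L" "L \<subseteq> val_ring v" "\<And>m. F m \<subseteq> L"
proof
  define L where "L = {x. \<exists>i m. (\<sigma> ^^ i) x \<in> F m}"
  have LI: "x \<in> L" if "(\<sigma> ^^ i) x \<in> F m" for x i m
    using that by (auto simp: L_def)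
  have mono': "F m \<subseteq> F (m + k)" for m k
    by (induction k) (use mono in auto)
  have sig': "(\<sigma> ^^ k) x \<in> F (m + k)" if "x \<in> F m" for x m k
    using that by (induction k) (use sig in auto)
  have add: "(\<sigma> ^^ i) (x + y) = (\<sigma> ^^ i) x + (\<sigma> ^^ i) y"
    and mult: "(\<sigma> ^^ i) (x * y) = (\<sigma> ^^ i) x * (\<sigma> ^^ i) y"
    and minus: "(\<sigma> ^^ i) (- x) = - (\<sigma> ^^ i) x"
    and one: "(\<sigma> ^^ i) 1 = 1" and zero: "(\<sigma> ^^ i) 0 = 0" for i x y
    by (induction i) (auto simp: sigma_add sigma_mult sigma.hom_minus sigma_one sigma.hom_zero)
  have inv: "(\<sigma> ^^ i) (inverse x) = inverse ((\<sigma> ^^ i) x)" for i x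
  proof (cases "x = 0")
    case False
    then have "(\<sigma> ^^ i) (inverse x) * (\<sigma> ^^ i) x = 1"
      by (simp add: mult[symmetric] one)
    then show ?thesis by (metis inverse_unique mult.commute)
  qed (simp add: zero)
  \<comment> \<open>Applying \<open>\<sigma> ^^ j\<close> on the side of \<open>x\<close> and
    \<open>\<sigma> ^^ i\<close> on the side of \<open>y\<close> equalises the exponents;
    monotonicity of the chain then equalises the stages.\<close>
  have common: "\<exists>i m. (\<sigma> ^^ i) x \<in> F m \<and> (\<sigma> ^^ i) y \<in> F m" if xy: "x \<in> L" "y \<in> L" for x y
  proof -
    obtain i m j l where "(\<sigma> ^^ i) x \<in> F m" "(\<sigma> ^^ j) y \<in> F l"
      using xy by (auto simp: L_def)
    then have "(\<sigma> ^^ (j + i)) x \<in> F (m + j)" "(\<sigma> ^^ (i + j)) y \<in> F (l + i)"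
      using sig'[of "(\<sigma> ^^ i) x" m j] sig'[of "(\<sigma> ^^ j) y" l i] by (simp_all add: funpow_add)
    then have "(\<sigma> ^^ (i + j)) x \<in> F (m + j + (l + i))" "(\<sigma> ^^ (i + j)) y \<in> F (m + j + (l + i))"
      using mono'[of "m + j" "l + i"] mono'[of "l + i" "m + j"] by (auto simp: add_ac)
    then show ?thesis by blast
  qed
  note s = is_subringD[OF is_subfieldD(1)[OF F(1)]]
  have "is_subfield L"
    unfolding is_subfield_def is_subring_def
  proof (intro conjI ballI impI)
    show "0 \<in> L" "1 \<in> L"
      using LI[of 0 0 0] LI[of 0 1 0] s(1,2)[of 0] by auto
    fix a assume a: "a \<in> L"
    then obtain i m where "(\<sigma> ^^ i) a \<in> F m" by (auto simp: L_def)
    then have "(\<sigma> ^^ i) (- a) \<in> F m" "(\<sigma> ^^ i) (inverse a) \<in> F m"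
      using s(5) is_subfieldD(2)[OF F(1)] by (auto simp: minus inv)
    then show "- a \<in> L" "inverse a \<in> L" by (blast intro: LI)+
    fix b assume "b \<in> L"
    then obtain i m where "(\<sigma> ^^ i) a \<in> F m" "(\<sigma> ^^ i) b \<in> F m"
      using common a by blast
    then have "(\<sigma> ^^ i) (a + b) \<in> F m" "(\<sigma> ^^ i) (a * b) \<in> F m"
      using s(3,4) by (auto simp: add mult)
    then show "a + b \<in> L" "a * b \<in> L" by (blast intro: LI)+
  qed
  moreover have "\<sigma> ` L \<subseteq> L"
  proof
    fix y assume "y \<in> \<sigma> ` L"
    then obtain x i m where "y = \<sigma> x" "(\<sigma> ^^ i) x \<in> F m" by (auto simp: L_def)
    then have "(\<sigma> ^^ i) y \<in> F (Suc m)" using sig by (auto simp: funpow_swap1[symmetric])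
    then show "y \<in> L" by (rule LI)
  qed
  moreover have "L \<subseteq> \<sigma> ` L"
  proof
    fix x assume "x \<in> L"
    then obtain i m where i: "(\<sigma> ^^ i) x \<in> F m" by (auto simp: L_def)
    obtain y where y: "x = \<sigma> y" using bij_is_surj[OF sigma_bij] by (metis surjD)
    \<comment> \<open>A preimage of \<open>x\<close> reaches the same stage with an exponent larger
      by one.\<close>
    have "(\<sigma> ^^ Suc i) y \<in> F m" using i y by (simp add: funpow_swap1)
    then have "y \<in> L" by (rule LI)
    then show "x \<in> \<sigma> ` L" using y by blast
  qed
  ultimately show "difference_subfield \<sigma> L" by (auto simp: difference_subfield_iff)
  show "L \<subseteq> val_ring v"
    using F(2) sigma_funpow_in_val_ring_iff by (fastforce simp: L_def)
  show "F m \<subseteq> L" for m using LI[of 0] by auto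
qed

text \<open>The conjugates of \<open>y\<close> are adjoined one by one: \<sigma> turns an
  annihilator of one into an annihilator of the next, so every step is algebraic and
  \<open>res_eq_0_adjoin_algebraic\<close> applies.\<close>

lemma difference_subfield_of_algebraic_chain:
  assumes A: "is_subfield A" "A \<subseteq> val_ring v" and y: "y \<in> val_ring v"
    and sig: "\<sigma> ` A \<subseteq> frac_set (adjoin A y)"
    and p: "p \<in> poly_over A" "p \<noteq> 0" "poly p y = 0"
  obtains L where "difference_subfield \<sigma> L" "L \<subseteq> val_ring v" "A \<subseteq> L" "y \<in> L"
proof -
  \<comment> \<open>\<open>F m\<close> is the field generated by \<open>A\<close> and the conjugates
    of \<open>y\<close> with exponent below \<open>m\<close>.\<close>
  define F where "F = rec_nat A (\<lambda>m B. frac_set (adjoin B ((\<sigma> ^^ m) y)))"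
  have F0: "F 0 = A" and FS: "F (Suc m) = frac_set (adjoin (F m) ((\<sigma> ^^ m) y))" for m
    by (simp_all add: F_def)
  have sup: "F m \<subseteq> F (Suc m)" "(\<sigma> ^^ m) y \<in> F (Suc m)" if "is_subfield (F m)" for m
    using frac_set_superset[OF is_subring_adjoin] adjoin_superset adjoin_generator
      is_subfieldD(1)[OF that] unfolding FS by blast+
  \<comment> \<open>The invariant carries an annihilator of the element that is to be adjoined
    next.\<close>
  have inv: "is_subfield (F m) \<and> F m \<subseteq> val_ring v \<and> \<sigma> ` F m \<subseteq> F (Suc m) \<and>
    (\<exists>p\<in>poly_over (F m). p \<noteq> 0 \<and> poly p ((\<sigma> ^^ m) y) = 0)" for m
  proof (induction m)
    case 0
    then show ?case using A sig p by (auto simp: F0 FS)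
  next
    case (Suc m)
    then obtain p where sf: "is_subfield (F m)" and val: "F m \<subseteq> val_ring v"
      and st: "\<sigma> ` F m \<subseteq> F (Suc m)"
      and p: "p \<in> poly_over (F m)" "p \<noteq> 0" "poly p ((\<sigma> ^^ m) y) = 0" by blast
    let ?R = "adjoin (F m) ((\<sigma> ^^ m) y)"
    have R: "is_subring ?R" by (rule is_subring_adjoin[OF is_subfieldD(1)[OF sf]])
    have sf': "is_subfield (F (Suc m))" unfolding FS by (rule is_subfield_frac_set[OF R])
    have ym: "(\<sigma> ^^ m) y \<in> val_ring v" using y by (simp add: sigma_funpow_in_val_ring_iff)
    have "?R \<subseteq> val_ring v" by (rule adjoin_least[OF is_subring_val_ring val ym])
    then have val': "F (Suc m) \<subseteq> val_ring v"
      unfolding FS using res_eq_0_adjoin_algebraic[OF sf val ym p] by (rule frac_set_val_ring)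
    have sf'': "is_subfield (F (Suc (Suc m)))"
      unfolding FS[of "Suc m"] by (rule is_subfield_frac_set[OF is_subring_adjoin[OF is_subfieldD(1)[OF sf']]])
    have "\<sigma> ` ?R \<subseteq> F (Suc (Suc m))"
      using sup[OF sf'] st by (intro sigma_adjoin is_subfieldD(1)[OF sf'']) auto
    then have st': "\<sigma> ` F (Suc m) \<subseteq> F (Suc (Suc m))"
      unfolding FS[of m] by (rule sigma_frac_set[OF sf''])
    have "map_poly \<sigma> p \<in> poly_over (F (Suc m))"
      using p(1) st by (auto simp: poly_over_def coeff_map_poly sigma.hom_zero)
    moreover have "map_poly \<sigma> p \<noteq> 0"
      using p(2) by (auto simp: poly_eq_iff coeff_map_poly sigma.hom_zero sigma_eq_0_iff)
    moreover have "poly (map_poly \<sigma> p) ((\<sigma> ^^ Suc m) y) = 0"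
      using sigma.hom_poly[of p "(\<sigma> ^^ m) y"] p(3) by (simp add: sigma.hom_zero)
    ultimately show ?case using sf' val' st' by blast
  qed
  obtain L where "difference_subfield \<sigma> L" "L \<subseteq> val_ring v" "\<And>m. F m \<subseteq> L"
    using difference_subfield_of_chain[of F] inv sup by blast
  then show ?thesis using that[of L] F0 sup(2)[of 0] inv[of 0] by (metis funpow_0 subsetD)
qed

end

subsection \<open>Extending the residue field\<close>

context valued_difference_field
begin

text \<open>
  Only for the least such \<open>n\<close> does \<open>q\<close> witness that the residue of $\sigma^n(a)$ is algebraic: the
  residues of $a,\dots,\sigma^{n-1}(a)$ are then independent, so that \<open>q\<close> keeps a nonzero residue.
\<close>

definition residue_algebraic :: "'a set \<Rightarrow> 'a \<Rightarrow> nat \<Rightarrow> 'a mvpoly poly \<Rightarrow> bool" where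
  "residue_algebraic E a n q \<longleftrightarrow> q \<in> poly_over (mv_gen E n) \<and> q \<noteq> 0 \<and>
     \<pi> (sigma_eval \<sigma> (poly q (mv_var n)) a) = 0"

text \<open>The residues of the first \<open>n\<close> conjugates of \<open>a\<close> are
  independent over those of \<open>E\<close>: a nonzero \<open>g\<close> violating this, read as a
  polynomial in its last variable, would witness \<open>residue_algebraic\<close> at an index below
  \<open>n\<close>.\<close>

lemma mv_gen_eq_0_of_res:
  assumes E: "is_subfield E" "E \<subseteq> val_ring v"
    and tr: "\<And>m q. m < n \<Longrightarrow> \<not> residue_algebraic E a m q"
    and g: "g \<in> mv_gen E n" "\<pi> (sigma_eval \<sigma> g a) = 0"
  shows "g = 0"
  using tr g
proof (induction n arbitrary: g)
  case 0
  note s = is_subringD[OF is_subfieldD(1)[OF E(1)]]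
  have "\<exists>c\<in>E. g = mv_const c"
    using 0(2)
  proof induction
    case (add f g)
    then show ?case using s(3) by (metis mv_const_add)
  next
    case (mult f g)
    then show ?case using s(4) by (metis mv_const_mult)
  qed auto
  then obtain c where c: "c \<in> E" "g = mv_const c" by blast
  then have "c = 0"
    using res_eq_0_subfield[OF E c(1)] 0(3) by simp
  then show ?case using c(2) by (simp add: mv_const_def)
next
  case (Suc n)
  obtain q where "q \<in> poly_over (mv_gen E n)" "g = poly q (mv_var n)"
    using Suc.prems(2) mv_gen_Suc[OF is_subfieldD(1)[OF E(1)], of n] by (auto simp: adjoin_def)
  then show ?case
    using Suc.prems(1)[of n q] Suc.prems(3) by (auto simp: residue_algebraic_def)
qed

text \<open>Independence is assumed at \<open>a\<close> and transfers to \<open>b\<close> because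
  the residues agree. It serves both for \<open>b = a\<close> and for the henselian lift.\<close>

lemma frac_set_sigma_eval:
  assumes E: "is_subfield E" "E \<subseteq> val_ring v"
    and tr: "\<And>m q. m < n \<Longrightarrow> \<not> residue_algebraic E a m q"
    and ab: "a \<in> val_ring v" "b \<in> val_ring v" "\<pi> a = \<pi> b"
  shows "is_subfield (frac_set ((\<lambda>g. sigma_eval \<sigma> g b) ` mv_gen E n))"
    and "frac_set ((\<lambda>g. sigma_eval \<sigma> g b) ` mv_gen E n) \<subseteq> val_ring v"
proof -
  note s = is_subfieldD(1)[OF E(1)]
  show "is_subfield (frac_set ((\<lambda>g. sigma_eval \<sigma> g b) ` mv_gen E n))"
    by (intro is_subfield_frac_set sigma_eval.is_subring_image is_subring_mv_gen s)
  show "frac_set ((\<lambda>g. sigma_eval \<sigma> g b) ` mv_gen E n) \<subseteq> val_ring v"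
  proof (rule frac_set_val_ring)
    show "(\<lambda>g. sigma_eval \<sigma> g b) ` mv_gen E n \<subseteq> val_ring v"
      using sigma_eval_val_ring[OF E(2) ab(2)] by blast
    fix x assume "x \<in> (\<lambda>g. sigma_eval \<sigma> g b) ` mv_gen E n" "\<pi> x = 0"
    then obtain g where g: "x = sigma_eval \<sigma> g b" "g \<in> mv_gen E n" "\<pi> (sigma_eval \<sigma> g b) = 0"
      by blast
    then have "g = 0"
      using mv_gen_eq_0_of_res[OF E tr] sigma_eval_res_cong[OF E(2) ab] by simp
    then show "x = 0" using g by (simp add: sigma_eval.hom_zero)
  qed
qed

text \<open>One unit among the first derivatives suffices: the others have non-negative value, so
  the minimum is \<open>0\<close>.\<close>

lemma henselian_lift:
  assumes hens: "sigma_henselian \<sigma> v"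
    and E: "is_subring E" "E \<subseteq> val_ring v" and a: "a \<in> val_ring v"
    and g: "g \<in> mv_gen E (Suc n)" "\<pi> (sigma_eval \<sigma> g a) = 0"
    and d: "\<pi> (sigma_eval \<sigma> (mv_partial n g) a) \<noteq> 0"
  obtains b where "b \<in> val_ring v" "\<pi> b = \<pi> a" "sigma_eval \<sigma> g b = 0"
proof -
  have val: "sigma_eval \<sigma> f a \<in> val_ring v" if "f \<in> mv_gen E (Suc n)" for f
    using sigma_eval_val_ring[OF E(2) a that] .
  have pos: "0 < val v (sigma_eval \<sigma> g a)"
    using res_eq_0_iff[OF val[OF g(1)]] g(2) by simp
  have "Min ((\<lambda>i. val v (sigma_eval \<sigma> (mv_taylor i g) a)) `
          {i. Poly_Mapping.keys i \<subseteq> {..n} \<and> mi_deg i = 1}) =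
      Min ((\<lambda>j. val v (sigma_eval \<sigma> (mv_partial j g) a)) ` {..n})"
    unfolding multiindices_deg_1 image_image mv_partial_def ..
  also have "\<dots> = 0"
  proof (rule Min_eqI)
    show "0 \<le> y" if "y \<in> (\<lambda>j. val v (sigma_eval \<sigma> (mv_partial j g) a)) ` {..n}" for y
      using that val mv_partial_mv_gen[OF E(1) g(1)] by (auto simp: val_ring_def)
    have "val v (sigma_eval \<sigma> (mv_partial n g) a) = 0"
      using val_eq_0_of_res[OF val[OF mv_partial_mv_gen[OF E(1) g(1)]] d] .
    then show "0 \<in> (\<lambda>j. val v (sigma_eval \<sigma> (mv_partial j g) a)) ` {..n}"
      by (metis (no_types, lifting) atMost_iff image_eqI order_refl)
  qed simp
  finally obtain b where b: "b \<in> val_ring v" "sigma_eval \<sigma> g b = 0"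
    "val v (sigma_eval \<sigma> g a) \<le> val v (a - b)"
    using hens mv_gen_mvpolys[OF g(1)] lookup_mv_gen[OF E(1) g(1)] E(2) a pos
    unfolding sigma_henselian_def by blast
  have "0 < val v (a - b)" using pos b(3) by (rule order.strict_trans2)
  then have "\<pi> (a - b) = 0" using res_eq_0_iff val_ringD(6)[OF a b(1)] by simp
  then show ?thesis using that b(1,2) res_diff[OF a b(1)] by simp
qed

text \<open>The conclusion concerns \<open>\<pi> a\<close> instead of \<open>a\<close>, since in the
  algebraic case \<open>L\<close> is built from a corrected lift \<open>b\<close>.\<close>

lemma difference_subfield_extend_residue:
  assumes hens: "sigma_henselian \<sigma> v" and char: "CHAR('k) = 0"
    and E: "difference_subfield \<sigma> E" "E \<subseteq> val_ring v" and a: "a \<in> val_ring v"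
  obtains L where "difference_subfield \<sigma> L" "L \<subseteq> val_ring v" "E \<subseteq> L" "\<pi> a \<in> \<pi> ` L"
proof -
  have sf: "is_subfield E" and sE: "\<sigma> ` E \<subseteq> E" using E(1) by (auto simp: difference_subfield_iff)
  note sr = is_subfieldD(1)[OF sf]
  define ev where "ev c g = sigma_eval \<sigma> g c" for c and g :: "'a mvpoly"
  have ev_hom: "comm_ring_hom_fun (ev c)" for c
    unfolding ev_def by (rule sigma_eval.comm_ring_hom_fun_axioms)
  \<comment> \<open>\<open>R c n\<close> is the ring generated by \<open>E\<close> and the
    conjugates of \<open>c\<close> with exponent below \<open>n\<close>.\<close>
  define R where "R c n = ev c ` mv_gen E n" for c n
  have R_sub: "R c n \<subseteq> frac_set (R c n)" for c n
    unfolding R_def by (intro frac_set_superset comm_ring_hom_fun.is_subring_image ev_hom is_subring_mv_gen sr)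
  have E_R: "E \<subseteq> R c n" for c n
    unfolding R_def ev_def by (auto intro!: image_eqI[where x = "mv_const _"] mv_gen.const)
  have gen_R: "(\<sigma> ^^ j) c \<in> R c n" if "j < n" for c j n
    unfolding R_def ev_def using that by (auto intro!: image_eqI[where x = "mv_var j"] mv_gen.var)
  have R_mono: "R c n \<subseteq> R c (Suc n)" for c n
    unfolding R_def using mv_gen_mono[of n "Suc n" E] by (simp add: image_mono)
  have sigma_R: "\<sigma> ` R c n \<subseteq> R c (Suc n)" for c n
    unfolding R_def ev_def using sigma_eval_step[OF sE] by auto
  show ?thesis
  proof (cases "\<exists>n q. residue_algebraic E a n q")
    case False
    define F where "F n = frac_set (R a n)" for n
    have F: "is_subfield (F n)" "F n \<subseteq> val_ring v" for n
      using frac_set_sigma_eval[OF sf E(2) _ a a refl, of n] False by (auto simp: F_def R_def ev_def)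
    have "F n \<subseteq> F (Suc n)" "\<sigma> ` F n \<subseteq> F (Suc n)" for n
      using frac_set_least[OF F(1)] sigma_frac_set[OF F(1)] R_mono sigma_R R_sub
      unfolding F_def by (meson order_trans)+
    then obtain L where L: "difference_subfield \<sigma> L" "L \<subseteq> val_ring v" "\<And>n. F n \<subseteq> L"
      using difference_subfield_of_chain[of F] F by blast
    \<comment> \<open>Stage \<open>1\<close> is the first that has \<open>a\<close> among its
      generators.\<close>
    have "E \<subseteq> L" "a \<in> L"
      using L(3)[of 1] E_R[of a 1] gen_R[of 0 1 a] R_sub[of a 1] by (auto simp: F_def)
    then show ?thesis using that L(1,2) by blast
  next
    case True
    define n where "n = (LEAST n. \<exists>q. residue_algebraic E a n q)"
    have ex: "\<exists>q. residue_algebraic E a n q" unfolding n_def using True by (rule LeastI_ex)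
    have tr: "\<not> residue_algebraic E a m q" if "m < n" for m q
      using not_less_Least that unfolding n_def by blast
    obtain q where q: "residue_algebraic E a n q"
      and q_min: "\<And>r. residue_algebraic E a n r \<Longrightarrow> degree q \<le> degree r"
      using ex ex_has_least_nat[of "residue_algebraic E a n" _ degree] by metis
    have q_over: "q \<in> poly_over (mv_gen E n)" and q0: "q \<noteq> 0"
      and q_res: "\<pi> (ev a (poly q (mv_var n))) = 0"
      using q by (auto simp: residue_algebraic_def ev_def)
    have res_eq_0: "g = 0" if "g \<in> mv_gen E n" "\<pi> (ev a g) = 0" for g
      using mv_gen_eq_0_of_res[OF sf E(2) tr] that by (simp add: ev_def)
    have lc: "lead_coeff q \<in> mv_gen E n" using q_over by (auto simp: poly_over_def)
    then have lc_res: "\<pi> (ev a (lead_coeff q)) \<noteq> 0" using res_eq_0 q0 by (metis leading_coeff_0_iff)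
    have ev_val: "ev c g \<in> val_ring v" if "c \<in> val_ring v" "g \<in> mv_gen E m" for c g m
      using sigma_eval_val_ring[OF E(2) that] by (simp add: ev_def)
    have deg: "degree q > 0"
    proof (rule ccontr)
      assume "\<not> degree q > 0"
      then obtain c where "q = [:c:]" by (metis degree_eq_zeroE gr0I)
      then show False using lc_res q_res by simp
    qed
    have nat_res: "of_nat k \<in> val_ring v \<and> \<pi> (of_nat k) = of_nat k" for k
      by (induction k) (auto simp: res_zero res_one res_add val_ringD)
    have of_nat_ev: "ev c (of_nat k) = of_nat k" for c k
      by (induction k) (auto simp: comm_ring_hom_fun.hom_zero[OF ev_hom]
          comm_ring_hom_fun.hom_one[OF ev_hom] comm_ring_hom_fun.hom_add[OF ev_hom])
    \<comment> \<open>The derivative has smaller degree than the minimal \<open>q\<close>, so it is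
      no witness. Once it is known to be nonzero and over the same ring, its residue must be
      nonzero.\<close>
    have "\<not> residue_algebraic E a n (pderiv q)"
    proof
      assume "residue_algebraic E a n (pderiv q)"
      then have "degree q \<le> degree (pderiv q)" by (rule q_min)
      also have "\<dots> \<le> degree q - 1" by (intro degree_le) (auto simp: coeff_pderiv coeff_eq_0)
      finally show False using deg by simp
    qed
    moreover have "pderiv q \<noteq> 0"
    proof
      assume "pderiv q = 0"
      then have "coeff (pderiv q) (degree q - 1) = 0" by simp
      then have "of_nat (degree q) * lead_coeff q = 0"
        using deg unfolding coeff_pderiv by simp
      \<comment> \<open>Evaluation carries the equation from the polynomial ring to the field, and
        \<pi> then carries it to \<open>'k\<close>, where characteristic zero applies.\<close>
      then have "ev a (of_nat (degree q) * lead_coeff q) = 0"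
        by (simp only: comm_ring_hom_fun.hom_zero[OF ev_hom])
      then have z: "of_nat (degree q) * ev a (lead_coeff q) = 0"
        by (simp only: comm_ring_hom_fun.hom_mult[OF ev_hom] of_nat_ev)
      have "\<pi> (of_nat (degree q) * ev a (lead_coeff q)) = 0"
        unfolding z by (rule res_zero)
      then have "of_nat (degree q) * \<pi> (ev a (lead_coeff q)) = 0"
        using nat_res ev_val[OF a lc] by (simp add: res_mult)
      then have "of_nat (degree q) = (0 :: 'k)" using lc_res by simp
      then show False using char deg by (simp add: of_nat_eq_0_iff_char_dvd)
    qed
    moreover have "pderiv q \<in> poly_over (mv_gen E n)"
    proof -
      note m = is_subringD[OF is_subring_mv_gen[OF sr]]
      have "of_nat k \<in> mv_gen E n" for k by (induction k) (auto intro: m)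
      then show ?thesis
        using q_over m(4) by (simp add: poly_over_def coeff_pderiv del: of_nat_Suc)
    qed
    ultimately have d: "\<pi> (ev a (mv_partial n (poly q (mv_var n)))) \<noteq> 0"
      unfolding mv_partial_poly[OF sr q_over] by (auto simp: residue_algebraic_def ev_def)
    have "poly q (mv_var n) \<in> mv_gen E (Suc n)"
      unfolding mv_gen_Suc[OF sr] adjoin_def using q_over by blast
    then obtain b where b: "b \<in> val_ring v" "\<pi> b = \<pi> a" "ev b (poly q (mv_var n)) = 0"
      using henselian_lift[OF hens sr E(2) a] q_res d unfolding ev_def by blast
    define A where "A = frac_set (R b n)"
    have A: "is_subfield A" "A \<subseteq> val_ring v"
      using frac_set_sigma_eval[OF sf E(2) tr a b(1) b(2)[symmetric]] by (auto simp: A_def R_def ev_def)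
    let ?y = "(\<sigma> ^^ n) b" and ?p = "map_poly (ev b) q"
    have zero: "ev b 0 = 0" by (rule comm_ring_hom_fun.hom_zero[OF ev_hom])
    have y: "?y \<in> val_ring v" using b(1) by (simp add: sigma_funpow_in_val_ring_iff)
    have "?p \<in> poly_over A"
      using q_over R_sub[of b n] by (auto simp: poly_over_def coeff_map_poly zero A_def R_def)
    moreover have "?p \<noteq> 0"
    proof -
      \<comment> \<open>The leading coefficient has the same residue at \<open>b\<close> as at
        \<open>a\<close>.\<close>
      have "\<pi> (ev b (lead_coeff q)) \<noteq> 0"
        using lc_res sigma_eval_res_cong[OF E(2) a b(1) b(2)[symmetric] lc] by (simp add: ev_def)
      then have "coeff ?p (degree q) \<noteq> 0" using res_zero by (auto simp: coeff_map_poly zero)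
      then show ?thesis by auto
    qed
    moreover have "poly ?p ?y = 0"
      using b(3) comm_ring_hom_fun.hom_poly[OF ev_hom, of b q "mv_var n"] by (simp add: ev_def)
    \<comment> \<open>\<sigma> raises exponents by one, and the only new generator this produces is
      \<open>?y\<close>.\<close>
    moreover have "\<sigma> ` A \<subseteq> frac_set (adjoin A ?y)"
    proof -
      let ?B = "adjoin A ?y"
      note B = is_subring_adjoin[OF is_subfieldD(1)[OF A(1)], of ?y]
      have "R b (Suc n) \<subseteq> ?B"
      proof -
        have "g \<in> mv_gen E (Suc n) \<Longrightarrow> ev b g \<in> ?B" for g
        proof (induction rule: mv_gen.induct)
          case (const c)
          then show ?case
            using E_R[of b n] R_sub[of b n] adjoin_superset[OF is_subfieldD(1)[OF A(1)], of ?y]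
            by (auto simp: ev_def A_def)
        next
          case (var j)
          then show ?case
            using gen_R[of j n b] R_sub[of b n] adjoin_superset[OF is_subfieldD(1)[OF A(1)], of ?y]
              adjoin_generator[OF is_subfieldD(1)[OF A(1)], of ?y]
            by (cases "j = n") (auto simp: ev_def A_def)
        qed (auto simp: comm_ring_hom_fun.hom_add[OF ev_hom] comm_ring_hom_fun.hom_mult[OF ev_hom]
            intro: is_subringD[OF B])
        then show ?thesis by (auto simp: R_def)
      qed
      then have "\<sigma> ` R b n \<subseteq> frac_set ?B"
        using sigma_R[of b n] frac_set_superset[OF B] by blast
      then show ?thesis
        unfolding A_def by (intro sigma_frac_set is_subfield_frac_set B[unfolded A_def])
    qed
    ultimately obtain L where L: "difference_subfield \<sigma> L" "L \<subseteq> val_ring v" "A \<subseteq> L" "?y \<in> L"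
      using difference_subfield_of_algebraic_chain[OF A y] by blast
    have "E \<subseteq> L" using E_R[of b n] R_sub[of b n] L(3) by (auto simp: A_def)
    moreover have "b \<in> L"
    \<comment> \<open>For \<open>n = 0\<close> the element \<open>b\<close> is \<open>?y\<close>
      itself; otherwise it is among the generators of \<open>A\<close>.\<close>
    proof (cases n)
      case 0
      then show ?thesis using L(4) by simp
    next
      case (Suc k)
      then show ?thesis using gen_R[of 0 n b] R_sub[of b n] L(3) by (auto simp: A_def)
    qed
    ultimately show ?thesis using that L(1,2) b(2) by (metis imageI)
  qed
qed

end

section \<open>Zorn's lemma\<close>

lemma difference_subfield_Union_chain:
  assumes "\<C> \<noteq> {}" "\<And>F. F \<in> \<C> \<Longrightarrow> difference_subfield \<sigma> F"
    and ch: "\<And>F G. F \<in> \<C> \<Longrightarrow> G \<in> \<C> \<Longrightarrow> F \<subseteq> G \<or> G \<subseteq> F"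
  shows "difference_subfield \<sigma> (\<Union>\<C>)"
proof -
  note F = assms(2)[unfolded difference_subfield_def]
  have two: "\<exists>F\<in>\<C>. a \<in> F \<and> b \<in> F" if "a \<in> \<Union>\<C>" "b \<in> \<Union>\<C>" for a b
    using that ch by blast
  have "a + b \<in> \<Union>\<C> \<and> a * b \<in> \<Union>\<C>" if "a \<in> \<Union>\<C>" "b \<in> \<Union>\<C>" for a b
    using two[OF that] F by blast
  moreover have "- a \<in> \<Union>\<C> \<and> (a \<noteq> 0 \<longrightarrow> inverse a \<in> \<Union>\<C>)" if "a \<in> \<Union>\<C>" for a
    using that F by blast
  moreover have "0 \<in> \<Union>\<C>" "1 \<in> \<Union>\<C>" using assms(1) F by blast+
  moreover have "\<sigma> ` \<Union>\<C> = \<Union>\<C>"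
  proof -
    have "(\<Union>F\<in>\<C>. \<sigma> ` F) = (\<Union>F\<in>\<C>. F)" using F by (intro SUP_cong) auto
    then show ?thesis by (simp add: image_Union)
  qed
  ultimately show ?thesis unfolding difference_subfield_def by blast
qed

theorem theorem5p8:
  fixes \<sigma> :: "'a::field \<Rightarrow> 'a"
    and v :: "'a \<Rightarrow> 'g::linordered_ab_group_add"
    and \<pi> :: "'a \<Rightarrow> 'k::field"
    and K\<^sub>0 :: "'a set"
  assumes "valued_difference_field \<sigma> v \<pi>"
    and "sigma_henselian \<sigma> v"
    and "CHAR('k) = 0"
    and "difference_subfield \<sigma> K\<^sub>0"
    and "K\<^sub>0 \<subseteq> val_ring v"
  shows "\<exists>K\<^sub>1. difference_subfield \<sigma> K\<^sub>1 \<and> K\<^sub>0 \<subseteq> K\<^sub>1 \<and> K\<^sub>1 \<subseteq> val_ring v \<and> \<pi> ` K\<^sub>1 = UNIV"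
proof -
  interpret valued_difference_field \<sigma> v \<pi> by fact
  define \<A> where "\<A> = {F. difference_subfield \<sigma> F \<and> K\<^sub>0 \<subseteq> F \<and> F \<subseteq> val_ring v}"
  have "\<exists>M\<in>\<A>. \<forall>X\<in>\<A>. M \<subseteq> X \<longrightarrow> X = M"
  proof (rule subset_Zorn_nonempty)
    show "\<A> \<noteq> {}" using assms(4,5) by (auto simp: \<A>_def)
    fix \<C> assume "\<C> \<noteq> {}" and ch: "subset.chain \<A> \<C>"
    then have "\<C> \<subseteq> \<A>" "\<And>F G. F \<in> \<C> \<Longrightarrow> G \<in> \<C> \<Longrightarrow> F \<subseteq> G \<or> G \<subseteq> F"
      by (auto simp: subset_chain_def)
    then show "\<Union>\<C> \<in> \<A>"
      using \<open>\<C> \<noteq> {}\<close> difference_subfield_Union_chain[of \<C> \<sigma>] unfolding \<A>_def by blast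
  qed
  then obtain M where M: "difference_subfield \<sigma> M" "K\<^sub>0 \<subseteq> M" "M \<subseteq> val_ring v"
    and max: "\<And>X. difference_subfield \<sigma> X \<Longrightarrow> M \<subseteq> X \<Longrightarrow> X \<subseteq> val_ring v \<Longrightarrow> X = M"
    unfolding \<A>_def by auto
  have "\<alpha> \<in> \<pi> ` M" for \<alpha>
  proof -
    obtain a where a: "a \<in> val_ring v" "\<pi> a = \<alpha>" using res_surj by (metis UNIV_I imageE)
    obtain L where "difference_subfield \<sigma> L" "L \<subseteq> val_ring v" "M \<subseteq> L" "\<pi> a \<in> \<pi> ` L"
      using difference_subfield_extend_residue[OF assms(2,3) M(1,3) a(1)] .
    \<comment> \<open>Maximality gives \<open>L = M\<close>, so the residue was already attained on
      \<open>M\<close>.\<close>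
    then show ?thesis using max[of L] a(2) by simp
  qed
  then show ?thesis using M by blast
qed

end
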